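(* Let $m,n \ge 1$ be integers and let $\Pi = \mathrm{diag}(\pi_1,\ldots,\pi_n) \in \mathbb{R}^{n\times n}$ with $\pi_i>0$ for all $i$ and $\sum_{i=1}^n \pi_i = 1$ be the input distribution. Then for all channels $C, \bar C \in \mathbb{R}^{m\times n}$ it holds: \[ C \trianglerighteq_{cS} \bar C \quad \Longleftrightarrow \quad C \succcurlyeq_{cS} \bar C. \]
   Context: A (real) matrix is called stochastic if it is column stochastic: all entries are nonnegative and each column sums to $1$. A channel is a stochastic matrix $C \in \mathbb{R}^{m \times n}$ ($m$ = length of the output alphabet, $n$ = length of the input alphabet). Convexified Shannon-order: $C \trianglerighteq_{cS} \bar C$ means that there exist a positive integer $\ell$, a probability distribution $q_1,\ldots,q_\ell$ (i.e. $q_j\ge 0$, $\sum_j q_j = 1$), and stochastic matrices $M_j \in \mathbb{R}^{m\times m}$, $N_j\in\mathbb{R}^{n\times n}$, $j=1,\ldots,\ell$, with $\bar C = \sum_{j=1}^{\ell} q_j\cdot M_j \cdot C\cdot N_j$. The convexified Shannon policy space of a channel $C$ is the set $\Phi_{cS}(C)$ of all $D \in \mathbb{R}^{m\times n}$ for which there exist a positive integer $k$, a probability distribution $p_1,\ldots,p_k$, and stochastic matrices $A_i \in \mathbb{R}^{m\times m}$, $B_i \in \mathbb{R}^{n\times n}$, $i=1,\ldots,k$, with $D = \sum_{i=1}^k p_i \cdot A_i\cdot C\cdot B_i$. Convexified Shannon-usefulness: $C \succcurlyeq_{cS} \bar C$ means that for all utility matrices $U \in \mathbb{R}^{n\times m}$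 \[ \max_{D \in \Phi_{cS}(C)} \mathrm{tr}(U\cdot D\cdot \Pi)\ \ge\ \max_{D \in \Phi_{cS}(\bar C)} \mathrm{tr}(U\cdot D\cdot \Pi). \] *)

theory Defs
  imports "HOL-Analysis.Analysis"
begin

text \<open>An \<open>m \<times> n\<close> matrix has type \<^typ>\<open>real ^ 'n ^ 'm\<close>; \<open>A $ i $ j\<close> is the entry in row \<open>i\<close>, column \<open>j\<close>.\<close>

definition stochastic :: "real ^ 'n ^ 'm \<Rightarrow> bool" where
  "stochastic A \<longleftrightarrow> (\<forall>i j. 0 \<le> A $ i $ j) \<and> (\<forall>j. (\<Sum>i\<in>UNIV. A $ i $ j) = 1)"

definition diag_matrix :: "real ^ 'n \<Rightarrow> real ^ 'n ^ 'n" where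
  "diag_matrix d = (\<chi> i j. if i = j then d $ i else 0)"

definition prob_dist :: "nat \<Rightarrow> (nat \<Rightarrow> real) \<Rightarrow> bool" where
  "prob_dist k p \<longleftrightarrow> (\<forall>i\<in>{1..k}. 0 \<le> p i) \<and> (\<Sum>i=1..k. p i) = 1"

definition cS_order :: "real ^ 'n ^ 'm \<Rightarrow> real ^ 'n ^ 'm \<Rightarrow> bool" where
  "cS_order C C' \<longleftrightarrow>
     (\<exists>(l::nat) q (M :: nat \<Rightarrow> real ^ 'm ^ 'm) (N :: nat \<Rightarrow> real ^ 'n ^ 'n).
        1 \<le> l \<and> prob_dist l q \<and>
        (\<forall>j\<in>{1..l}. stochastic (M j) \<and> stochastic (N j)) \<and>
        C' = (\<Sum>j=1..l. q j *\<^sub>R (M j ** C ** N j)))"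

definition cS_policy_space :: "real ^ 'n ^ 'm \<Rightarrow> (real ^ 'n ^ 'm) set" where
  "cS_policy_space C =
     {D. \<exists>(k::nat) p (A :: nat \<Rightarrow> real ^ 'm ^ 'm) (B :: nat \<Rightarrow> real ^ 'n ^ 'n).
           1 \<le> k \<and> prob_dist k p \<and>
           (\<forall>i\<in>{1..k}. stochastic (A i) \<and> stochastic (B i)) \<and>
           D = (\<Sum>i=1..k. p i *\<^sub>R (A i ** C ** B i))}"

text \<open>The maximum ranges over an infinite set, so it is the \<^const>\<open>Greatest\<close> value rather than
  \<^const>\<open>Max\<close>. It is attained: see \<open>cS_max_utility_attained\<close> below.\<close>

definition cS_max_utility :: "real ^ 'n \<Rightarrow> real ^ 'm ^ 'n \<Rightarrow> real ^ 'n ^ 'm \<Rightarrow> real" where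
  "cS_max_utility d U C =
     (GREATEST v. v \<in> (\<lambda>D. trace (U ** D ** diag_matrix d)) ` cS_policy_space C)"

lemma compact_stochastic: "compact {A :: real ^ 'n ^ 'm. stochastic A}"
proof -
  have "closed {A :: real ^ 'n ^ 'm. stochastic A}"
    unfolding stochastic_def
    by (intro closed_Collect_conj closed_Collect_all closed_Collect_le closed_Collect_eq
        continuous_intros)
  moreover have "bounded {A :: real ^ 'n ^ 'm. stochastic A}"
  proof (rule boundedI)
    fix A :: "real ^ 'n ^ 'm"
    assume "A \<in> {A. stochastic A}"
    then have nn: "\<And>i j. 0 \<le> A $ i $ j" and col: "\<And>j. (\<Sum>i\<in>UNIV. A $ i $ j) = 1"
      by (auto simp: stochastic_def)
    have le1: "\<bar>A $ i $ j\<bar> \<le> 1" for i j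
      using member_le_sum[of i UNIV "\<lambda>i. A $ i $ j"] nn col by auto
    have "norm A \<le> (\<Sum>i\<in>UNIV. norm (A $ i))"
      unfolding norm_vec_def by (rule L2_set_le_sum) simp
    also have "\<dots> \<le> (\<Sum>i\<in>(UNIV::'m set). \<Sum>j\<in>(UNIV::'n set). (1::real))"
      by (intro sum_mono order_trans[OF norm_le_l1_cart]) (rule le1)
    finally show "norm A \<le> (\<Sum>i\<in>(UNIV::'m set). \<Sum>j\<in>(UNIV::'n set). (1::real))" .
  qed
  ultimately show ?thesis by (simp add: compact_eq_bounded_closed)
qed

lemma stochastic_mat_1: "stochastic (mat 1 :: real ^ 'n ^ 'n)"
  by (auto simp: stochastic_def mat_def)

lemma cS_policy_space_eq_convex_hull:
  "cS_policy_space C =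
     convex hull ((\<lambda>(A, B). A ** C ** B) ` ({A. stochastic A} \<times> {B. stochastic B}))"
  (is "_ = convex hull ?S")
proof (intro equalityI subsetI)
  fix D assume "D \<in> cS_policy_space C"
  then obtain k p A B where h: "prob_dist k p"
      "\<forall>i\<in>{1..k}. stochastic (A i) \<and> stochastic (B i)"
      "D = (\<Sum>i=1..k. p i *\<^sub>R (A i ** C ** B i))"
    unfolding cS_policy_space_def by (elim CollectE exE conjE) (rule that)
  have "A i ** C ** B i \<in> convex hull ?S" if "i \<in> {1..k}" for i
    by (intro hull_inc image_eqI[of _ _ "(A i, B i)"]) (use h(2) that in simp_all)
  moreover have "sum p {1..k} = 1" "\<And>i. i \<in> {1..k} \<Longrightarrow> 0 \<le> p i"
    using h(1) by (simp_all add: prob_dist_def)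
  ultimately show "D \<in> convex hull ?S"
    unfolding h(3) by (intro convex_sum finite_atLeastAtMost convex_convex_hull)
next
  fix D assume "D \<in> convex hull ?S"
  then obtain k :: nat and u x where h: "\<forall>i\<in>{1..k}. 0 \<le> u i \<and> x i \<in> ?S"
      "sum u {1..k} = 1" "(\<Sum>i=1..k. u i *\<^sub>R x i) = D"
    unfolding convex_hull_indexed by (elim CollectE exE conjE) (rule that)
  from h(1) have "\<forall>i\<in>{1..k}. \<exists>P. stochastic (fst P) \<and> stochastic (snd P) \<and> x i = fst P ** C ** snd P"
    by (force simp: image_iff)
  from bchoice[OF this] obtain P where P: "\<forall>i\<in>{1..k}. stochastic (fst (P i)) \<and> stochastic (snd (P i)) \<and>
      x i = fst (P i) ** C ** snd (P i)"
    by (rule exE)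
  have "1 \<le> k" using h(2) by (cases k) auto
  moreover have "D = (\<Sum>i=1..k. u i *\<^sub>R (fst (P i) ** C ** snd (P i)))"
    unfolding h(3)[symmetric] by (rule sum.cong) (use P in simp_all)
  ultimately show "D \<in> cS_policy_space C"
    unfolding cS_policy_space_def prob_dist_def mem_Collect_eq using h(1,2) P
    by (intro exI[of _ k] exI[of _ u] exI[of _ "fst \<circ> P"] exI[of _ "snd \<circ> P"]) simp
qed

lemma compact_cS_policy_space: "compact (cS_policy_space C)"
  unfolding cS_policy_space_eq_convex_hull
  by (intro compact_convex_hull compact_continuous_image compact_Times compact_stochastic)
     (auto simp: matrix_matrix_mult_def case_prod_unfold intro!: continuous_intros)

lemma cS_policy_space_nonempty: "cS_policy_space C \<noteq> {}"
  unfolding cS_policy_space_eq_convex_hull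
  by (simp add: ex_in_conv[symmetric]) (blast intro: stochastic_mat_1)

lemma cS_max_utility_attained:
  obtains D where "D \<in> cS_policy_space C"
    and "cS_max_utility d U C = trace (U ** D ** diag_matrix d)"
    and "\<And>E. E \<in> cS_policy_space C \<Longrightarrow> trace (U ** E ** diag_matrix d) \<le> cS_max_utility d U C"
proof -
  have "continuous_on (cS_policy_space C) (\<lambda>D. trace (U ** D ** diag_matrix d))"
    by (auto simp: trace_def matrix_matrix_mult_def intro!: continuous_intros)
  then obtain D where D: "D \<in> cS_policy_space C"
    "\<And>E. E \<in> cS_policy_space C \<Longrightarrow>
      trace (U ** E ** diag_matrix d) \<le> trace (U ** D ** diag_matrix d)"
    using continuous_attains_sup[OF compact_cS_policy_space cS_policy_space_nonempty] by blast
  then have "cS_max_utility d U C = trace (U ** D ** diag_matrix d)"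
    unfolding cS_max_utility_def by (intro Greatest_equality) auto
  with D that show ?thesis by auto
qed

definition cS_useful :: "real ^ 'n \<Rightarrow> real ^ 'n ^ 'm \<Rightarrow> real ^ 'n ^ 'm \<Rightarrow> bool" where
  "cS_useful d C C' \<longleftrightarrow>
     (\<forall>U :: real ^ 'm ^ 'n. cS_max_utility d U C \<ge> cS_max_utility d U C')"

end

theory Submission
  imports Defs
begin

text \<open>The order \<open>cS_order C C'\<close> says exactly that \<open>C'\<close> lies in the policy space of \<open>C\<close>.
  The policy space is stable under multiplication by stochastic matrices on both sides, so it then
  contains the policy space of \<open>C'\<close>, and the maximal utilities compare. Conversely, a \<open>C'\<close> outside
  the compact convex policy space of \<open>C\<close> is strictly separated from it by a linear functional, and
  since all input probabilities are positive, every linear functional is the expected utility of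
  some \<open>U\<close>.\<close>

lemma cS_order_iff_mem: "cS_order C C' \<longleftrightarrow> C' \<in> cS_policy_space C"
  by (simp add: cS_order_def cS_policy_space_def)

lemma stochastic_mult:
  fixes A :: "real ^ 'k ^ 'm" and B :: "real ^ 'n ^ 'k"
  assumes "stochastic A" "stochastic B"
  shows "stochastic (A ** B)"
proof -
  have "(\<Sum>i\<in>UNIV. \<Sum>k\<in>UNIV. A $ i $ k * B $ k $ j) = 1" for j
  proof -
    have "(\<Sum>i\<in>UNIV. \<Sum>k\<in>UNIV. A $ i $ k * B $ k $ j)
        = (\<Sum>k\<in>UNIV. (\<Sum>i\<in>UNIV. A $ i $ k) * B $ k $ j)"
      by (subst sum.swap) (simp add: sum_distrib_right)
    with assms show ?thesis by (simp add: stochastic_def)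
  qed
  with assms show ?thesis
    by (auto simp: stochastic_def matrix_matrix_mult_def intro!: sum_nonneg)
qed

lemma linear_matrix_mult_both: "linear (\<lambda>D :: real ^ 'n ^ 'm. A ** D ** B)"
  by (rule linearI)
     (simp_all add: vec_eq_iff matrix_matrix_mult_def algebra_simps sum.distrib
        sum_distrib_left sum_distrib_right)

text \<open>The generators \<open>A' ** C ** B'\<close> are mapped to
  \<open>(A ** A') ** C ** (B' ** B)\<close>, which are again generators because products of
  stochastic matrices are stochastic. The linear map \<open>X \<mapsto> A ** X ** B\<close> commutes
  with convex hulls, so this extends to the whole policy space.\<close>

lemma cS_policy_space_mult:
  assumes "stochastic A" "stochastic B" "D \<in> cS_policy_space C"
  shows "A ** D ** B \<in> cS_policy_space C"
proof -
  let ?S = "(\<lambda>(A, B). A ** C ** B) ` ({A. stochastic A} \<times> {B. stochastic B})"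
  have "A ** X ** B \<in> ?S" if "X \<in> ?S" for X
  proof -
    from that obtain A' B' where "stochastic A'" "stochastic B'" "X = A' ** C ** B'"
      by auto
    then show ?thesis
      using assms by (intro image_eqI[of _ _ "(A ** A', B' ** B)"])
        (auto simp: matrix_mul_assoc stochastic_mult)
  qed
  then have "(\<lambda>X. A ** X ** B) ` ?S \<subseteq> ?S" by blast
  then have "(\<lambda>X. A ** X ** B) ` (convex hull ?S) \<subseteq> convex hull ?S"
    by (subst convex_hull_linear_image[OF linear_matrix_mult_both]) (rule hull_mono)
  with assms(3) show ?thesis
    unfolding cS_policy_space_eq_convex_hull by blast
qed

lemma self_mem_cS_policy_space: "C \<in> cS_policy_space C"
  unfolding cS_policy_space_eq_convex_hull
  by (intro hull_inc image_eqI[of _ _ "(mat 1, mat 1)"]) (simp_all add: stochastic_mat_1)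

lemma cS_policy_space_mono:
  assumes "C' \<in> cS_policy_space C"
  shows "cS_policy_space C' \<subseteq> cS_policy_space C"
  unfolding cS_policy_space_eq_convex_hull[of C']
proof (rule hull_minimal)
  show "(\<lambda>(A, B). A ** C' ** B) ` ({A. stochastic A} \<times> {B. stochastic B}) \<subseteq> cS_policy_space C"
    using assms by (auto intro: cS_policy_space_mult)
  show "convex (cS_policy_space C)"
    by (simp add: cS_policy_space_eq_convex_hull)
qed

lemma trace_mult_diag_matrix:
  fixes U :: "real ^ 'm ^ 'n" and D :: "real ^ 'n ^ 'm"
  shows "trace (U ** D ** diag_matrix d) = (\<Sum>i\<in>UNIV. \<Sum>j\<in>UNIV. U $ j $ i * d $ j * D $ i $ j)"
proof -
  have "trace (U ** D ** diag_matrix d) = (\<Sum>j\<in>UNIV. (\<Sum>i\<in>UNIV. U $ j $ i * D $ i $ j) * d $ j)"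
    by (simp add: trace_def matrix_matrix_mult_def diag_matrix_def if_distrib cong: if_cong)
  also have "\<dots> = (\<Sum>j\<in>UNIV. \<Sum>i\<in>UNIV. U $ j $ i * d $ j * D $ i $ j)"
    by (simp add: sum_distrib_left mult_ac)
  finally show ?thesis by (subst (asm) sum.swap)
qed

text \<open>Column \<open>j\<close> of \<open>D\<close> enters the trace with weight
  \<open>d $ j\<close>. Dividing the transpose of \<open>W\<close> by these nonzero weights cancels
  them.\<close>

lemma inner_eq_trace_diag_matrix:
  fixes W :: "real ^ 'n ^ 'm"
  assumes "\<And>j. d $ j \<noteq> 0"
  obtains U :: "real ^ 'm ^ 'n" where "\<And>D. trace (U ** D ** diag_matrix d) = inner W D"
proof (rule that[of "\<chi> j i. W $ i $ j / d $ j"])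
  show "trace ((\<chi> j i. W $ i $ j / d $ j) ** D ** diag_matrix d) = inner W D" for D
    using assms by (simp add: trace_mult_diag_matrix inner_vec_def)
qed

theorem theorem2:
  fixes d :: "real ^ 'n"
    and C C' :: "real ^ 'n ^ 'm"
  assumes "\<And>i. d $ i > 0"
    and "(\<Sum>i\<in>UNIV. d $ i) = 1"
    and "stochastic C"
    and "stochastic C'"
  shows "cS_order C C' \<longleftrightarrow> cS_useful d C C'"
proof
  assume "cS_order C C'"
  then have "cS_policy_space C' \<subseteq> cS_policy_space C"
    by (simp add: cS_order_iff_mem cS_policy_space_mono)
  \<comment> \<open>An optimal policy for \<open>C'\<close> is also available to
    \<open>C\<close>.\<close>
  then show "cS_useful d C C'"
    unfolding cS_useful_def by (metis cS_max_utility_attained subsetD)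
next
  assume useful: "cS_useful d C C'"
  show "cS_order C C'"
  proof (rule ccontr)
    assume "\<not> cS_order C C'"
    then have "C' \<notin> cS_policy_space C" by (simp add: cS_order_iff_mem)
    moreover have "convex (cS_policy_space C)"
      by (simp add: cS_policy_space_eq_convex_hull)
    ultimately obtain a b where ab: "inner a C' < b" "\<forall>D\<in>cS_policy_space C. b < inner a D"
      using separating_hyperplane_closed_point compact_imp_closed[OF compact_cS_policy_space]
      by metis
    have "d $ j \<noteq> 0" for j using assms(1)[of j] by simp
    \<comment> \<open>The separation puts \<open>C'\<close> on the lower side of the hyperplane; the
      sign change makes its utility exceed that of every policy of \<open>C\<close>.\<close>
    then obtain U :: "real ^ 'm ^ 'n" where U: "\<And>D. trace (U ** D ** diag_matrix d) = inner (- a) D"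
      using inner_eq_trace_diag_matrix by blast
    obtain D where "D \<in> cS_policy_space C" "cS_max_utility d U C = inner (- a) D"
      using cS_max_utility_attained[of C d U] U by metis
    with ab have "cS_max_utility d U C < inner (- a) C'" by force
    \<comment> \<open>\<open>C'\<close> is one of its own policies, so its utility bounds the
      maximum from below.\<close>
    also have "inner (- a) C' \<le> cS_max_utility d U C'"
      using cS_max_utility_attained[of C' d U] self_mem_cS_policy_space U by metis
    finally show False using useful by (force simp: cS_useful_def not_le[symmetric])
  qed
qed

end
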